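(* Let $M$ be a finite set, let $(\lambda,\mathcal{L})$ be a ranked lattice of subsets of $M$ and let $\mu$ be a measure on $M$. Let $r(A)=\min\{\lambda(Z)+\mu(A\setminus Z): Z\in\mathcal{L}\}$ for $A\subseteq M$. Suppose that for all $Z_1,Z_2\in\mathcal{L}$ $$\lambda(Z_1)+\lambda(Z_2)\ge \lambda(Z_1\lor Z_2)+\lambda(Z_1\land Z_2)+\mu\big((Z_1\cap Z_2)\setminus(Z_1\land Z_2)\big).$$ Then $(r,M)$ is a polymatroid.
   Context: A polymatroid $(f,M)$ is a non-negative, monotone, submodular real function $f$ on the subsets of the finite set $M$ (the condition $f(\emptyset)=0$ is not part of this definition). A measure on $M$ is a non-negative additive function $\mu$ on the subsets of $M$, i.e. $\mu(A)=\sum_{a\in A}\mu(\{a\})$ with $\mu(\{a\})\ge 0$. A lattice $\mathcal{L}$ of subsets of $M$ is a non-empty collection of subsets of $M$ which is a lattice under the inclusion order: any $Z_1,Z_2\in\mathcal{L}$ have in $\mathcal{L}$ a least upper bound $Z_1\lor Z_2$ and a greatest lower bound $Z_1\land Z_2$ (these need not be the union and the intersection). A ranked lattice $(\lambda,\mathcal{L})$ is such a lattice with a function $\lambda:\mathcal{L}\to\mathbb{R}_{\ge0}$ (not assumed monotone). *)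

theory Defs
  imports Complex_Main "HOL-Algebra.Lattice"
begin

definition polymatroid :: "('a set \<Rightarrow> real) \<Rightarrow> 'a set \<Rightarrow> bool" where
  "polymatroid f M \<longleftrightarrow>
     finite M \<and>
     (\<forall>A. A \<subseteq> M \<longrightarrow> 0 \<le> f A) \<and>
     (\<forall>A B. A \<subseteq> B \<and> B \<subseteq> M \<longrightarrow> f A \<le> f B) \<and>
     (\<forall>A B. A \<subseteq> M \<and> B \<subseteq> M \<longrightarrow> f (A \<union> B) + f (A \<inter> B) \<le> f A + f B)"

definition measure_on :: "('a set \<Rightarrow> real) \<Rightarrow> 'a set \<Rightarrow> bool" where
  "measure_on \<mu> M \<longleftrightarrow>
     (\<forall>A. A \<subseteq> M \<longrightarrow> \<mu> A = (\<Sum>a\<in>A. \<mu> {a})) \<and> (\<forall>a\<in>M. 0 \<le> \<mu> {a})"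

definition inclusion_order :: "'a set set \<Rightarrow> 'a set gorder" where
  "inclusion_order \<L> = \<lparr>carrier = \<L>, eq = (=), le = (\<subseteq>)\<rparr>"

(* Joins and meets are those of the order restricted to \<L>; they need not be
   unions and intersections. *)
definition set_lattice :: "'a set set \<Rightarrow> 'a set \<Rightarrow> bool" where
  "set_lattice \<L> M \<longleftrightarrow> \<L> \<noteq> {} \<and> \<L> \<subseteq> Pow M \<and> Lattice.lattice (inclusion_order \<L>)"

definition ranked_lattice :: "('a set \<Rightarrow> real) \<Rightarrow> 'a set set \<Rightarrow> 'a set \<Rightarrow> bool" where
  "ranked_lattice rk \<L> M \<longleftrightarrow> set_lattice \<L> M \<and> (\<forall>Z\<in>\<L>. 0 \<le> rk Z)"

(* For finite M the family \<L> is finite, so Min is taken over a finite non-empty set. *)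
definition lattice_convolution ::
  "('a set \<Rightarrow> real) \<Rightarrow> 'a set set \<Rightarrow> ('a set \<Rightarrow> real) \<Rightarrow> 'a set \<Rightarrow> real" where
  "lattice_convolution rk \<L> \<mu> A = Min ((\<lambda>Z. rk Z + \<mu> (A - Z)) ` \<L>)"

end

theory Submission
  imports Defs
begin

text \<open>Take Z1 and Z2 attaining the minimum at A and at B, and bound the values at A \<union> B and
  A \<inter> B by those of the join and of the meet. As the join contains Z1 \<union> Z2 and the meet is
  contained in Z1 \<inter> Z2, comparing the weight of each single point shows that the change in the
  measure terms is at most the measure of Z1 \<inter> Z2 minus the meet, which the hypothesis absorbs.\<close>

text \<open>Indexing the sum by all of \<open>M\<close>, with default value 0 off \<open>A\<close>,
  puts the measures of different sets over one common index set, so that inequalities between them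
  can be checked point by point.\<close>

lemma measure_on_as_sum:
  assumes "finite M" "measure_on \<mu> M" "A \<subseteq> M"
  shows "\<mu> A = (\<Sum>a\<in>M. if a \<in> A then \<mu> {a} else 0)"
proof -
  have "\<mu> A = (\<Sum>a\<in>A. \<mu> {a})"
    using assms by (simp add: measure_on_def)
  also have "\<dots> = (\<Sum>a\<in>M. if a \<in> A then \<mu> {a} else 0)"
    using assms by (simp add: sum.inter_restrict [symmetric] inf.absorb2)
  finally show ?thesis .
qed

lemma measure_on_nonneg:
  assumes "measure_on \<mu> M" "A \<subseteq> M"
  shows "0 \<le> \<mu> A"
proof -
  have "0 \<le> (\<Sum>a\<in>A. \<mu> {a})"
    using assms by (intro sum_nonneg) (auto simp: measure_on_def)
  then show ?thesis
    using assms by (simp add: measure_on_def)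
qed

lemma measure_on_mono:
  assumes "finite M" "measure_on \<mu> M" "A \<subseteq> B" "B \<subseteq> M"
  shows "\<mu> A \<le> \<mu> B"
proof -
  have "(\<Sum>a\<in>A. \<mu> {a}) \<le> (\<Sum>a\<in>B. \<mu> {a})"
    using assms by (intro sum_mono2) (auto simp: measure_on_def intro: finite_subset)
  then show ?thesis
    using assms by (simp add: measure_on_def)
qed

text \<open>A point of \<open>A \<union> B - J\<close> lies outside both \<open>Z1\<close> and
  \<open>Z2\<close>, so it is counted in \<open>A - Z1\<close> or \<open>B - Z2\<close>, and in both
  if it belongs to \<open>A \<inter> B\<close>. Any other point of \<open>A \<inter> B - K\<close>
  either misses one of \<open>Z1\<close>, \<open>Z2\<close>, and is counted in the corresponding
  difference, or lies in \<open>Z1 \<inter> Z2 - K\<close>.\<close>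

lemma measure_on_uncrossing:
  assumes fin: "finite M" and \<mu>: "measure_on \<mu> M"
    and AB: "A \<subseteq> M" "B \<subseteq> M" and Z: "Z1 \<subseteq> M" "Z2 \<subseteq> M"
    and J: "Z1 \<union> Z2 \<subseteq> J" and K: "K \<subseteq> Z1 \<inter> Z2"
  shows "\<mu> (A \<union> B - J) + \<mu> (A \<inter> B - K) \<le> \<mu> (A - Z1) + \<mu> (B - Z2) + \<mu> (Z1 \<inter> Z2 - K)"
proof -
  have sub: "A \<union> B - J \<subseteq> M" "A \<inter> B - K \<subseteq> M" "A - Z1 \<subseteq> M" "B - Z2 \<subseteq> M" "Z1 \<inter> Z2 - K \<subseteq> M"
    using AB Z by auto
  have "0 \<le> \<mu> {a}" if "a \<in> M" for a
    using \<mu> that unfolding measure_on_def by blast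
  then show ?thesis
    \<comment> \<open>All five measures become sums over \<open>M\<close> and each side merges into
      a single sum. What remains for one point is a case distinction on membership, in which any
      surplus on the right is nonnegative.\<close>
    unfolding sub [THEN measure_on_as_sum [OF fin \<mu>]] sum.distrib [symmetric]
    using J K by (intro sum_mono) auto
qed

text \<open>An upper bound for inclusion contains both sets and hence their union; dually for the
  meet. These inclusions are what \<open>measure_on_uncrossing\<close> requires.\<close>

lemma set_lattice_join_meet:
  assumes "set_lattice \<L> M" "X \<in> \<L>" "Y \<in> \<L>"
  shows "X \<squnion>\<^bsub>inclusion_order \<L>\<^esub> Y \<in> \<L>"
    and "X \<sqinter>\<^bsub>inclusion_order \<L>\<^esub> Y \<in> \<L>"
    and "X \<union> Y \<subseteq> X \<squnion>\<^bsub>inclusion_order \<L>\<^esub> Y"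
    and "X \<sqinter>\<^bsub>inclusion_order \<L>\<^esub> Y \<subseteq> X \<inter> Y"
proof -
  interpret Lattice.lattice "inclusion_order \<L>"
    using assms by (simp add: set_lattice_def)
  show "X \<squnion>\<^bsub>inclusion_order \<L>\<^esub> Y \<in> \<L>" "X \<sqinter>\<^bsub>inclusion_order \<L>\<^esub> Y \<in> \<L>"
    using join_closed [of X Y] meet_closed [of X Y] assms by (simp_all add: inclusion_order_def)
  show "X \<union> Y \<subseteq> X \<squnion>\<^bsub>inclusion_order \<L>\<^esub> Y" "X \<sqinter>\<^bsub>inclusion_order \<L>\<^esub> Y \<subseteq> X \<inter> Y"
    using join_left [of X Y] join_right [of X Y] meet_left [of X Y] meet_right [of X Y] assms
    by (simp_all add: inclusion_order_def)
qed

lemma lattice_convolution_le: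
  assumes "finite \<L>" "Z \<in> \<L>"
  shows "lattice_convolution rk \<L> \<mu> A \<le> rk Z + \<mu> (A - Z)"
  using assms by (simp add: lattice_convolution_def)

lemma lattice_convolution_attained:
  assumes "finite \<L>" "\<L> \<noteq> {}"
  obtains Z where "Z \<in> \<L>" "lattice_convolution rk \<L> \<mu> A = rk Z + \<mu> (A - Z)"
proof -
  have "lattice_convolution rk \<L> \<mu> A \<in> (\<lambda>Z. rk Z + \<mu> (A - Z)) ` \<L>"
    unfolding lattice_convolution_def using assms by (intro Min_in) auto
  then show thesis
    using that by auto
qed

theorem theorem7:
  fixes M :: "'a set" and \<L> :: "'a set set" and rk \<mu> :: "'a set \<Rightarrow> real"
  assumes "finite M"
    and "ranked_lattice rk \<L> M"
    and "measure_on \<mu> M"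
    and "\<And>Z1 Z2. \<lbrakk>Z1 \<in> \<L>; Z2 \<in> \<L>\<rbrakk> \<Longrightarrow>
           rk Z1 + rk Z2 \<ge>
             rk (Z1 \<squnion>\<^bsub>inclusion_order \<L>\<^esub> Z2) + rk (Z1 \<sqinter>\<^bsub>inclusion_order \<L>\<^esub> Z2)
             + \<mu> ((Z1 \<inter> Z2) - (Z1 \<sqinter>\<^bsub>inclusion_order \<L>\<^esub> Z2))"
  shows "polymatroid (lattice_convolution rk \<L> \<mu>) M"
proof -
  have lat: "set_lattice \<L> M" and rk: "\<And>Z. Z \<in> \<L> \<Longrightarrow> 0 \<le> rk Z"
    using assms(2) by (auto simp: ranked_lattice_def)
  have ne: "\<L> \<noteq> {}" and sub: "\<And>Z. Z \<in> \<L> \<Longrightarrow> Z \<subseteq> M" and fin: "finite \<L>"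
    using lat assms(1) by (auto simp: set_lattice_def intro: finite_subset [of _ "Pow M"])
  let ?r = "lattice_convolution rk \<L> \<mu>"
  have nonneg: "0 \<le> ?r A" if "A \<subseteq> M" for A
  proof -
    obtain Z where Z: "Z \<in> \<L>" "?r A = rk Z + \<mu> (A - Z)"
      using lattice_convolution_attained [OF fin ne] .
    have "0 \<le> \<mu> (A - Z)"
      using that by (intro measure_on_nonneg [OF assms(3)]) auto
    then show ?thesis
      using Z rk by simp
  qed
  have mono: "?r A \<le> ?r B" if "A \<subseteq> B" "B \<subseteq> M" for A B
  proof -
    \<comment> \<open>The minimizer for the larger set \<open>B\<close> is also a candidate for
      \<open>A\<close>, at no greater cost.\<close>
    obtain Z where Z: "Z \<in> \<L>" "?r B = rk Z + \<mu> (B - Z)"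
      using lattice_convolution_attained [OF fin ne] .
    have "\<mu> (A - Z) \<le> \<mu> (B - Z)"
      using that by (intro measure_on_mono [OF assms(1,3)]) auto
    then show ?thesis
      using lattice_convolution_le [OF fin Z(1), of rk \<mu> A] Z(2) by simp
  qed
  have submod: "?r (A \<union> B) + ?r (A \<inter> B) \<le> ?r A + ?r B" if "A \<subseteq> M" "B \<subseteq> M" for A B
  proof -
    obtain Z1 where Z1: "Z1 \<in> \<L>" "?r A = rk Z1 + \<mu> (A - Z1)"
      using lattice_convolution_attained [OF fin ne] .
    obtain Z2 where Z2: "Z2 \<in> \<L>" "?r B = rk Z2 + \<mu> (B - Z2)"
      using lattice_convolution_attained [OF fin ne] .
    define J where "J = Z1 \<squnion>\<^bsub>inclusion_order \<L>\<^esub> Z2"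
    define K where "K = Z1 \<sqinter>\<^bsub>inclusion_order \<L>\<^esub> Z2"
    note JK = set_lattice_join_meet [OF lat Z1(1) Z2(1), folded J_def K_def]
    have "?r (A \<union> B) + ?r (A \<inter> B) \<le> (rk J + rk K) + (\<mu> (A \<union> B - J) + \<mu> (A \<inter> B - K))"
      using lattice_convolution_le [OF fin JK(1), of rk \<mu> "A \<union> B"]
        lattice_convolution_le [OF fin JK(2), of rk \<mu> "A \<inter> B"] by simp
    also have "\<dots> \<le> (rk J + rk K) + (\<mu> (A - Z1) + \<mu> (B - Z2) + \<mu> (Z1 \<inter> Z2 - K))"
      using measure_on_uncrossing [OF assms(1,3) that sub [OF Z1(1)] sub [OF Z2(1)] JK(3,4)]
      by simp
    \<comment> \<open>The extra term \<open>\<mu> (Z1 \<inter> Z2 - K)\<close> left by the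
      uncrossing is exactly the one in the hypothesis on \<open>rk\<close>, so
      \<open>rk Z1 + rk Z2\<close> pays for it together with \<open>rk J + rk K\<close>.\<close>
    also have "\<dots> \<le> ?r A + ?r B"
      using assms(4) [OF Z1(1) Z2(1), folded J_def K_def] Z1(2) Z2(2) by simp
    finally show ?thesis .
  qed
  show ?thesis
    unfolding polymatroid_def using assms(1) nonneg mono submod by simp
qed

end
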